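(* The Erdős–Rényi graphs $G(n,p)$ which, when coarsened with coarsening ratio $r=\Theta\!\left(\frac{n}{m+n}\right)$, preserve the node degree of the previous layer up to constant factors can be restricted to $$p(n)=\Theta(n^{-\beta})\quad\text{with}\quad \beta\in\left[0,\tfrac12\right]\cup[1,\infty).$$
   Context: $G(n,p)$ is the Erdős–Rényi random graph on $n$ nodes, in which each of the $\binom n2$ possible edges is present independently with probability $p=p(n)$; $m$ denotes its number of edges, with $\mathbb{E}[m]=\binom n2 p$. The coarsening considered is a random coarsening with equal cluster sizes ($\pm1$): with coarsening ratio $r$, the node set is randomly partitioned into $q=\lfloor r\cdot n\rfloor$ clusters $K_1,\dots,K_q$ of equal size up to $\pm1$. The coarsened graph (the next layer) has one node $v_i$ (super-node) per cluster $K_i$, and an edge $\{v_i,v_j\}$, $i\ne j$, if there is at least one edge of $G$ between $K_i$ and $K_j$. Edges within a single layer are called horizontal; in addition, vertical edges join each node to its super-node in the next layer. Node degrees are average node degrees, taken in expectation and compared up to constant factors, with respect to horizontal and vertical edges; the original average node degree is measured as $\frac{m+n}{n}$.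
   Formalization: The form p(n)=Θ(n^{-β}) is assumed, not derived: p=n^{-1/4} log n also preserves the degree but is no power of n. Within this family, preservation is proved to hold exactly for β in [0,1/2] ∪ [1,∞), with r taken via E[m]. *)

theory Defs
  imports "HOL-Probability.Probability" "HOL-Probability.Product_PMF"
    "HOL-Library.Landau_Symbols"
begin

definition all_edges :: "nat \<Rightarrow> nat set set" where
  "all_edges n = {e. e \<subseteq> {..<n} \<and> card e = 2}"

text \<open>The graph $G(n,p)$ on the nodes $0, \dots, n-1$, represented by its random edge set.\<close>

definition gnp :: "nat \<Rightarrow> real \<Rightarrow> nat set set pmf" where
  "gnp n p = map_pmf (\<lambda>f. {e \<in> all_edges n. f e})
     (Pi_pmf (all_edges n) False (\<lambda>_. bernoulli_pmf p))"

definition expected_edges :: "nat \<Rightarrow> real \<Rightarrow> real" where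
  "expected_edges n p = measure_pmf.expectation (gnp n p) (\<lambda>E. real (card E))"

definition num_clusters :: "real \<Rightarrow> nat \<Rightarrow> nat" where
  "num_clusters r n = nat \<lfloor>r * real n\<rfloor>"

text \<open>A partition into \<open>q\<close> clusters is given by the map \<open>c\<close> sending each node to the index
  of its cluster.\<close>

definition cluster :: "nat \<Rightarrow> (nat \<Rightarrow> nat) \<Rightarrow> nat \<Rightarrow> nat set" where
  "cluster n c i = {v. v < n \<and> c v = i}"

definition balanced_partitions :: "nat \<Rightarrow> nat \<Rightarrow> (nat \<Rightarrow> nat) set" where
  "balanced_partitions n q = {c \<in> {..<n} \<rightarrow>\<^sub>E {..<q}.
     \<forall>i<q. \<forall>j<q. card (cluster n c i) \<le> card (cluster n c j) + 1}"

text \<open>For \<open>1 \<le> q \<le> n\<close> all clusters of a balanced partition are nonempty, so every unlabelled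
  partition arises from exactly \<open>q!\<close> maps; hence the uniform distribution on the maps induces
  the uniform distribution on the unlabelled balanced partitions.\<close>

definition random_partition :: "nat \<Rightarrow> nat \<Rightarrow> (nat \<Rightarrow> nat) pmf" where
  "random_partition n q = pmf_of_set (balanced_partitions n q)"

definition coarse_edges :: "nat \<Rightarrow> nat \<Rightarrow> (nat \<Rightarrow> nat) \<Rightarrow> nat set set \<Rightarrow> nat set set" where
  "coarse_edges n q c E = {{i, j} | i j. i < q \<and> j < q \<and> i \<noteq> j \<and>
     (\<exists>u \<in> cluster n c i. \<exists>v \<in> cluster n c j. {u, v} \<in> E)}"

text \<open>In the two-layer graph, \<open>Inl v\<close> is an original node and \<open>Inr i\<close> the super-node of
  cluster \<open>i\<close>.\<close>

definition horizontal_edges ::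
    "nat \<Rightarrow> nat \<Rightarrow> (nat \<Rightarrow> nat) \<Rightarrow> nat set set \<Rightarrow> (nat + nat) set set" where
  "horizontal_edges n q c E = (\<lambda>e. Inl ` e) ` E \<union> (\<lambda>e. Inr ` e) ` coarse_edges n q c E"

definition vertical_edges :: "nat \<Rightarrow> (nat \<Rightarrow> nat) \<Rightarrow> (nat + nat) set set" where
  "vertical_edges n c = (\<lambda>v. {Inl v, Inr (c v)}) ` {..<n}"

definition degree_in :: "'a set set \<Rightarrow> 'a \<Rightarrow> nat" where
  "degree_in F x = card {e \<in> F. x \<in> e}"

definition coarse_average_degree ::
    "nat \<Rightarrow> nat \<Rightarrow> (nat \<Rightarrow> nat) \<Rightarrow> nat set set \<Rightarrow> real" where
  "coarse_average_degree n q c E =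
     (\<Sum>i<q. real (degree_in (horizontal_edges n q c E \<union> vertical_edges n c) (Inr i))) / real q"

text \<open>The random partition is drawn independently of the graph.\<close>

definition expected_coarse_degree :: "nat \<Rightarrow> real \<Rightarrow> real \<Rightarrow> real" where
  "expected_coarse_degree n p r = (let q = num_clusters r n in
     measure_pmf.expectation (pair_pmf (gnp n p) (random_partition n q))
       (\<lambda>(E, c). coarse_average_degree n q c E))"

text \<open>The degree of the original layer counts each of the \<open>m\<close> horizontal and \<open>n\<close> vertical
  edges once, following the convention $(m+n)/n$; this differs from the average of the vertex
  degrees, $(2m+n)/n$, by at most a factor of 2.\<close>

definition expected_original_degree :: "nat \<Rightarrow> real \<Rightarrow> real" where
  "expected_original_degree n p = (expected_edges n p + real n) / real n"

definition preserves_degree :: "(nat \<Rightarrow> real) \<Rightarrow> (nat \<Rightarrow> real) \<Rightarrow> bool" where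
  "preserves_degree p r \<longleftrightarrow>
     (\<lambda>n. expected_coarse_degree n (p n) (r n)) \<in> \<Theta>(\<lambda>n. expected_original_degree n (p n))"

end

theory Submission
  imports Defs "HOL-Real_Asymp.Real_Asymp"
begin

text \<open>
  Write \<open>q\<close> for the number of clusters and \<open>d\<close> for the original degree; then
  \<open>q = \<Theta>(n / d)\<close>, with \<open>d = \<Theta>(n powr (1 - \<beta>))\<close> for \<open>0 \<le> \<beta> \<le> 1\<close> and
  \<open>d = \<Theta>(1)\<close> for \<open>\<beta> \<ge> 1\<close>. A super-node has on average exactly \<open>n / q = \<Theta>(d)\<close> vertical
  edges, so the degree is preserved iff the horizontal degree \<open>H\<close> of the super-nodes is \<open>O(d)\<close>.
  Trivially \<open>H \<le> q = O(d)\<close> for \<open>\<beta> \<le> 1/2\<close>, and counting the surviving edges gives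
  \<open>H \<le> p n\<^sup>2 / q = O(1)\<close> for \<open>\<beta> \<ge> 1\<close>. As clusters have at least \<open>n / (2 q)\<close> nodes, two
  super-nodes are adjacent with probability at least \<open>x / (1 + x)\<close>, where
  \<open>x = p n\<^sup>2 / (4 q\<^sup>2)\<close>, hence \<open>H \<ge> (q - 1) x / (1 + x)\<close>, which exceeds \<open>O(d)\<close> for
  \<open>1/2 < \<beta> < 1\<close>. Exponents \<open>\<beta> < 0\<close> are impossible because \<open>p \<le> 1\<close>.
\<close>

subsection \<open>Edge probabilities\<close>

lemma finite_all_edges: "finite (all_edges n)"
  unfolding all_edges_def by (rule finite_subset[of _ "Pow {..<n}"]) auto

lemma card_all_edges: "card (all_edges n) = n choose 2"
  unfolding all_edges_def using n_subsets[of "{..<n}" 2] by simp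

lemma set_pmf_gnp: "set_pmf (gnp n p) \<subseteq> Pow (all_edges n)"
  unfolding gnp_def by auto

lemma finite_set_pmf_gnp: "finite (set_pmf (gnp n p))"
  using finite_subset[OF set_pmf_gnp] finite_all_edges by blast

text \<open>Avoiding \<open>S\<close> is a product event for the independent indicators: coordinates
  in \<open>S\<close> must be \<open>False\<close>, the others are free. Each edge of
  \<open>S\<close> thus contributes a factor \<open>1 - p\<close>.\<close>

lemma prob_gnp_avoids:
  assumes "S \<subseteq> all_edges n" "0 \<le> p" "p \<le> 1"
  shows "measure_pmf.prob (gnp n p) {E. E \<inter> S = {}} = (1 - p) ^ card S"
proof -
  have "(\<lambda>f. {e \<in> all_edges n. f e}) -` {E. E \<inter> S = {}}
      = Pi (all_edges n) (\<lambda>e. if e \<in> S then {False} else UNIV)"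
    using assms(1) by (auto simp: Pi_def split: if_splits)
  hence "measure_pmf.prob (gnp n p) {E. E \<inter> S = {}} =
      (\<Prod>e\<in>all_edges n. measure_pmf.prob (bernoulli_pmf p) (if e \<in> S then {False} else UNIV))"
    unfolding gnp_def by (simp add: measure_Pi_pmf_Pi finite_all_edges)
  also have "\<dots> = (\<Prod>e\<in>all_edges n. if e \<in> S then 1 - p else 1)"
    using assms by (intro prod.cong) (auto simp: measure_pmf_single)
  also have "\<dots> = (1 - p) ^ card S"
    using assms(1) finite_all_edges[of n] by (simp add: prod.If_cases Int_absorb1)
  finally show ?thesis .
qed

text \<open>Serves two purposes: a singleton \<open>S\<close> gives the presence of one edge, and
  the potential edges between two clusters give the adjacency of their super-nodes.\<close>

lemma expectation_gnp_hits:
  assumes "S \<subseteq> all_edges n" "0 \<le> p" "p \<le> 1"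
  shows "measure_pmf.expectation (gnp n p) (\<lambda>E. of_bool (E \<inter> S \<noteq> {}) :: real)
    = 1 - (1 - p) ^ card S"
proof -
  have "(\<lambda>E. of_bool (E \<inter> S \<noteq> {}) :: real) = indicator (- {E. E \<inter> S = {}})"
    by (auto simp: indicator_def fun_eq_iff)
  hence "measure_pmf.expectation (gnp n p) (\<lambda>E. of_bool (E \<inter> S \<noteq> {}) :: real)
    = measure_pmf.prob (gnp n p) (- {E. E \<inter> S = {}})"
    by simp
  also have "\<dots> = 1 - (1 - p) ^ card S"
    using measure_pmf.prob_compl[of "{E. E \<inter> S = {}}" "gnp n p"] prob_gnp_avoids[OF assms]
    by (simp add: Compl_eq_Diff_UNIV)
  finally show ?thesis .
qed

lemma expected_edges_eq:
  assumes "0 \<le> p" "p \<le> 1"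
  shows "expected_edges n p = real (n choose 2) * p"
proof -
  have "expected_edges n p = measure_pmf.expectation (gnp n p)
      (\<lambda>E. \<Sum>e\<in>all_edges n. of_bool (E \<inter> {e} \<noteq> {}))"
    unfolding expected_edges_def
  \<comment> \<open>Counting \<open>E\<close> through indicators of possible edges is valid only if
    \<open>E\<close> consists of possible edges, so the integrands agree on the support, not
    everywhere.\<close>
  proof (intro integral_cong_AE)
    show "AE E in measure_pmf (gnp n p).
        real (card E) = (\<Sum>e\<in>all_edges n. of_bool (E \<inter> {e} \<noteq> {}))"
      unfolding AE_measure_pmf_iff
    proof
      fix E assume "E \<in> set_pmf (gnp n p)"
      hence "E \<subseteq> all_edges n" using set_pmf_gnp by blast
      thus "real (card E) = (\<Sum>e\<in>all_edges n. of_bool (E \<inter> {e} \<noteq> {}))"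
        using finite_all_edges[of n] by (simp add: Int_absorb1)
    qed
  qed auto
  also have "\<dots> = (\<Sum>e\<in>all_edges n. measure_pmf.expectation (gnp n p)
      (\<lambda>E. of_bool (E \<inter> {e} \<noteq> {})))"
    by (intro Bochner_Integration.integral_sum integrable_measure_pmf_finite finite_set_pmf_gnp)
  also have "\<dots> = (\<Sum>e\<in>all_edges n. p)"
    by (intro sum.cong refl, subst expectation_gnp_hits) (use assms in auto)
  finally show ?thesis by (simp add: card_all_edges)
qed

lemma expected_original_degree_eq:
  assumes "0 \<le> p" "p \<le> 1" "n \<ge> 1"
  shows "expected_original_degree n p = 1 + (real n - 1) * p / 2"
proof -
  have choose: "real (n choose 2) = real n * (real n - 1) / 2"
    using assms(3) by (simp add: choose_two real_of_nat_div of_nat_diff)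
  show ?thesis
    using assms unfolding expected_original_degree_def expected_edges_eq[OF assms(1,2)] choose
    by (simp add: field_simps)
qed

subsection \<open>The coarse degree for a fixed partition\<close>

text \<open>The complete bipartite graph between two clusters; super-nodes \<open>i\<close> and
  \<open>j\<close> are adjacent iff \<open>E\<close> meets it.\<close>

definition edges_between :: "nat \<Rightarrow> (nat \<Rightarrow> nat) \<Rightarrow> nat \<Rightarrow> nat \<Rightarrow> nat set set" where
  "edges_between n c i j = (\<lambda>(u, v). {u, v}) ` (cluster n c i \<times> cluster n c j)"

lemma finite_cluster: "finite (cluster n c i)"
  unfolding cluster_def by simp

lemma edges_between_subset: "i \<noteq> j \<Longrightarrow> edges_between n c i j \<subseteq> all_edges n"
  unfolding edges_between_def all_edges_def cluster_def by (auto simp: card_2_iff)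

text \<open>Distinct clusters are disjoint, so an unordered pair determines which endpoint lies in
  which cluster.\<close>

lemma card_edges_between:
  assumes "i \<noteq> j"
  shows "card (edges_between n c i j) = card (cluster n c i) * card (cluster n c j)"
proof -
  have "inj_on (\<lambda>(u, v). {u, v}) (cluster n c i \<times> cluster n c j)"
    using assms by (auto simp: inj_on_def cluster_def doubleton_eq_iff)
  thus ?thesis
    unfolding edges_between_def by (simp add: card_image card_cartesian_product)
qed

lemma sum_card_clusters:
  assumes "c \<in> {..<n} \<rightarrow> {..<q}"
  shows "(\<Sum>i<q. card (cluster n c i)) = n"
proof -
  have "card (\<Union>i<q. cluster n c i) = (\<Sum>i<q. card (cluster n c i))"
    by (rule card_UN_disjoint) (auto simp: cluster_def)
  moreover have "(\<Union>i<q. cluster n c i) = {..<n}"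
    using assms by (auto simp: cluster_def)
  ultimately show ?thesis by simp
qed

text \<open>The edges at \<open>Inr i\<close> are coarse edges to neighbours \<open>Inr j\<close>
  and vertical edges from members \<open>Inl v\<close>. The two families are disjoint, and each is
  parametrised injectively.\<close>

lemma degree_in_super_node:
  assumes "i < q"
  shows "degree_in (horizontal_edges n q c E \<union> vertical_edges n c) (Inr i) =
    card (cluster n c i) + card {j \<in> {..<q} - {i}. E \<inter> edges_between n c i j \<noteq> {}}"
proof -
  define N where "N = {j \<in> {..<q} - {i}. E \<inter> edges_between n c i j \<noteq> {}}"
  \<comment> \<open>The pair \<open>{i, j}\<close> may enter \<open>coarse_edges\<close> in either
    order; symmetry identifies the two conditions.\<close>
  have sym: "edges_between n c a b = edges_between n c b a" for a b
    unfolding edges_between_def by (auto simp: insert_commute image_iff)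
  have hit: "(\<exists>u\<in>cluster n c a. \<exists>v\<in>cluster n c b. {u, v} \<in> E) \<longleftrightarrow> E \<inter> edges_between n c a b \<noteq> {}" for a b
    unfolding edges_between_def by auto
  have coarse: "{i, j} \<in> coarse_edges n q c E \<longleftrightarrow> j \<in> N" for j
    unfolding coarse_edges_def N_def hit mem_Collect_eq doubleton_eq_iff using assms sym[of i j]
    by blast
  have "{e \<in> horizontal_edges n q c E \<union> vertical_edges n c. Inr i \<in> e}
      = (\<lambda>j. {Inr i, Inr j}) ` N \<union> (\<lambda>v. {Inl v, Inr i}) ` cluster n c i" (is "?L = ?R")
  proof (intro equalityI subsetI)
    fix e assume e: "e \<in> ?L"
    then consider (h) e' where "e = Inr ` e'" "e' \<in> coarse_edges n q c E" "i \<in> e'"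
      | (v) "e \<in> vertical_edges n c"
      unfolding horizontal_edges_def by auto
    thus "e \<in> ?R"
    proof cases
      case h
      from h(2,3) obtain j where j: "e' = {i, j}"
        unfolding coarse_edges_def by auto
      with h(1,2) coarse have "e = {Inr i, Inr j}" "j \<in> N" by auto
      thus ?thesis by blast
    next
      case v
      with e show ?thesis unfolding vertical_edges_def cluster_def by auto
    qed
  next
    fix e assume "e \<in> ?R"
    thus "e \<in> ?L"
    proof
      assume "e \<in> (\<lambda>j. {Inr i, Inr j}) ` N"
      then obtain j where "j \<in> N" "e = Inr ` {i, j}" by auto
      thus ?thesis unfolding horizontal_edges_def using coarse by blast
    next
      assume "e \<in> (\<lambda>v. {Inl v, Inr i}) ` cluster n c i"
      thus ?thesis unfolding vertical_edges_def cluster_def by auto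
    qed
  qed
  moreover have "card ?R = card N + card (cluster n c i)"
  proof -
    have "inj_on (\<lambda>j. {Inr i, Inr j} :: (nat + nat) set) N"
      by (auto simp: inj_on_def doubleton_eq_iff)
    moreover have "inj_on (\<lambda>v. {Inl v, Inr i} :: (nat + nat) set) (cluster n c i)"
      by (auto simp: inj_on_def doubleton_eq_iff)
    moreover have "finite N" unfolding N_def by simp
    ultimately show ?thesis
      by (subst card_Un_disjoint) (auto simp: card_image finite_cluster doubleton_eq_iff)
  qed
  ultimately show ?thesis
    unfolding degree_in_def N_def by simp
qed

text \<open>Every node has one vertical edge, so these contribute \<open>n / q\<close> for every
  partition. The double sum runs over ordered pairs, counting each coarse edge at both ends.\<close>

lemma coarse_average_degree_eq:
  assumes "c \<in> {..<n} \<rightarrow> {..<q}"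
  shows "coarse_average_degree n q c E = real n / real q +
    (\<Sum>i<q. \<Sum>j\<in>{..<q} - {i}. of_bool (E \<inter> edges_between n c i j \<noteq> {})) / real q"
proof -
  have "(\<Sum>i<q. real (degree_in (horizontal_edges n q c E \<union> vertical_edges n c) (Inr i)))
    = real (\<Sum>i<q. card (cluster n c i)) +
      (\<Sum>i<q. real (card {j \<in> {..<q} - {i}. E \<inter> edges_between n c i j \<noteq> {}}))"
    by (simp add: degree_in_super_node sum.distrib)
  also have "(\<Sum>i<q. real (card {j \<in> {..<q} - {i}. E \<inter> edges_between n c i j \<noteq> {}}))
    = (\<Sum>i<q. \<Sum>j\<in>{..<q} - {i}. of_bool (E \<inter> edges_between n c i j \<noteq> {}))"
    by (intro sum.cong refl, subst sum_of_bool_eq) (auto intro!: arg_cong[where f = card])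
  finally show ?thesis
    unfolding coarse_average_degree_def sum_card_clusters[OF assms] by (simp add: add_divide_distrib)
qed

lemma expectation_coarse_average_degree:
  assumes "c \<in> {..<n} \<rightarrow> {..<q}" "0 \<le> p" "p \<le> 1"
  shows "measure_pmf.expectation (gnp n p) (coarse_average_degree n q c) = real n / real q +
    (\<Sum>i<q. \<Sum>j\<in>{..<q} - {i}. 1 - (1 - p) ^ (card (cluster n c i) * card (cluster n c j))) / real q"
proof -
  have int: "integrable (measure_pmf (gnp n p)) f" for f :: "nat set set \<Rightarrow> real"
    by (intro integrable_measure_pmf_finite finite_set_pmf_gnp)
  have "measure_pmf.expectation (gnp n p) (coarse_average_degree n q c) = real n / real q +
    (\<Sum>i<q. \<Sum>j\<in>{..<q} - {i}. measure_pmf.expectation (gnp n p)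
       (\<lambda>E. of_bool (E \<inter> edges_between n c i j \<noteq> {}))) / real q"
    unfolding coarse_average_degree_eq[OF assms(1)]
    by (simp add: int Bochner_Integration.integral_add Bochner_Integration.integral_sum
        del: sum_of_bool_eq)
  also have "(\<Sum>i<q. \<Sum>j\<in>{..<q} - {i}. measure_pmf.expectation (gnp n p)
       (\<lambda>E. of_bool (E \<inter> edges_between n c i j \<noteq> {}) :: real)) =
     (\<Sum>i<q. \<Sum>j\<in>{..<q} - {i}. 1 - (1 - p) ^ (card (cluster n c i) * card (cluster n c j)))"
    using assms(2,3)
    by (intro sum.cong refl) (subst expectation_gnp_hits[OF edges_between_subset], auto simp: card_edges_between)
  finally show ?thesis .
qed

subsection \<open>Bounds on the expected coarse degree\<close>

text \<open>The union bound, as an instance of Bernoulli's inequality.\<close>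

lemma hitting_probability_le:
  fixes p :: real
  assumes "0 \<le> p" "p \<le> 1"
  shows "1 - (1 - p) ^ k \<le> real k * p"
  using Bernoulli_inequality[of "- p" k] assms by simp

text \<open>Bernoulli gives \<open>1 + x \<le> (1 + p) ^ k\<close>, and
  \<open>(1 - p) ^ k * (1 + p) ^ k \<le> 1\<close>; hence
  \<open>(1 - p) ^ k \<le> 1 / (1 + x)\<close>. The bound has the order of
  \<open>min 1 x\<close>.\<close>

lemma hitting_probability_ge:
  fixes p x :: real
  assumes "0 \<le> p" "p \<le> 1" "0 \<le> x" "x \<le> real k * p"
  shows "x / (1 + x) \<le> 1 - (1 - p) ^ k"
proof -
  have "(1 - p) ^ k * (1 + x) \<le> (1 - p) ^ k * (1 + p) ^ k"
    using Bernoulli_inequality[of p k] assms by (intro mult_left_mono) auto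
  also have "\<dots> = (1 - p\<^sup>2) ^ k"
    by (simp add: power2_eq_square algebra_simps flip: power_mult_distrib)
  also have "\<dots> \<le> 1"
    using assms by (intro power_le_one) (auto simp: power_le_one)
  finally show ?thesis
    using assms(3) by (simp add: divide_simps) (simp add: algebra_simps)
qed

text \<open>If a cluster has \<open>s\<close> nodes, the others have at most \<open>s + 1\<close>
  each. With \<open>s = 0\<close> this would allow only \<open>q - 1 < n\<close> nodes; so
  \<open>s + 1 \<le> 2 * s\<close>, which is the source of the factor 2.\<close>

lemma balanced_cluster_ge:
  assumes "c \<in> balanced_partitions n q" "1 \<le> q" "q \<le> n" "i < q"
  shows "real n / (2 * real q) \<le> real (card (cluster n c i))"
proof -
  let ?s = "card (cluster n c i)"
  have c: "c \<in> {..<n} \<rightarrow> {..<q}" and b: "\<And>j. j < q \<Longrightarrow> card (cluster n c j) \<le> ?s + 1"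
    using assms(1,4) unfolding balanced_partitions_def PiE_def by auto
  have "n = ?s + (\<Sum>j\<in>{..<q} - {i}. card (cluster n c j))"
    using sum_card_clusters[OF c] assms(4) sum.remove[of "{..<q}" i "\<lambda>j. card (cluster n c j)"]
    by simp
  also have "(\<Sum>j\<in>{..<q} - {i}. card (cluster n c j)) \<le> (\<Sum>j\<in>{..<q} - {i}. ?s + 1)"
    using b by (intro sum_mono) auto
  also have "\<dots> = (q - 1) * (?s + 1)"
    using assms(4) by simp
  finally have *: "n \<le> ?s + (q - 1) * (?s + 1)" by simp
  have "?s \<ge> 1"
  proof (rule ccontr)
    assume "\<not> ?s \<ge> 1"
    hence "?s = 0" by simp
    with * assms(2,3) show False by simp
  qed
  have "(q - 1) * (?s + 1) \<le> (q - 1) * (2 * ?s)"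
    using \<open>?s \<ge> 1\<close> by (intro mult_le_mono2) simp
  with * have "n \<le> ?s + (q - 1) * (2 * ?s)" by linarith
  also have "\<dots> \<le> 2 * q * ?s"
    using assms(2) by (cases q) (auto simp: algebra_simps)
  finally have "real n \<le> real (2 * q * ?s)" by (simp only: of_nat_le_iff)
  thus ?thesis using assms(2) by (simp add: field_simps)
qed

text \<open>\<open>pmf_of_set\<close> has the expected support only for a finite nonempty set, so a
  balanced partition has to be exhibited.\<close>

lemma set_pmf_random_partition:
  assumes "1 \<le> q"
  shows "set_pmf (random_partition n q) = balanced_partitions n q"
    and "finite (balanced_partitions n q)"
proof -
  show fin: "finite (balanced_partitions n q)"
    unfolding balanced_partitions_def
    by (rule finite_subset[of _ "{..<n} \<rightarrow>\<^sub>E {..<q}"]) (auto intro: finite_PiE)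
  \<comment> \<open>Residue classes modulo \<open>q\<close> have \<open>n div q\<close> or
    \<open>n div q + 1\<close> members below \<open>n\<close>; \<open>restrict\<close> makes the map
    extensional.\<close>
  let ?c = "restrict (\<lambda>v. v mod q) {..<n}"
  have size: "n div q \<le> card (cluster n ?c i) \<and> card (cluster n ?c i) \<le> n div q + 1"
    if "i < q" for i
  proof -
    have inj: "inj_on (\<lambda>a. q * a + i) A" for A
      using assms by (auto simp: inj_on_def)
    have "(\<lambda>a. q * a + i) ` {..<n div q} \<subseteq> cluster n ?c i"
    proof
      fix v assume "v \<in> (\<lambda>a. q * a + i) ` {..<n div q}"
      then obtain a where "a < n div q" "v = q * a + i" by blast
      hence a: "a + 1 \<le> n div q" "v = q * a + i" by auto
      have "v < q * (a + 1)" using a(2) that by simp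
      also have "\<dots> \<le> q * (n div q)" using a(1) by (intro mult_le_mono2)
      also have "\<dots> \<le> n" by simp
      finally show "v \<in> cluster n ?c i" using a(2) that by (simp add: cluster_def)
    qed
    from card_mono[OF finite_cluster this] have "n div q \<le> card (cluster n ?c i)"
      by (simp add: card_image[OF inj])
    moreover have "cluster n ?c i \<subseteq> (\<lambda>a. q * a + i) ` {..<n div q + 1}"
    proof
      fix v assume "v \<in> cluster n ?c i"
      hence v: "v < n" "v mod q = i" by (auto simp: cluster_def)
      have "v = q * (v div q) + i" using v(2) mult_div_mod_eq[of q v] by simp
      moreover have "v div q < n div q + 1" using v(1) div_le_mono[of v n q] by simp
      ultimately show "v \<in> (\<lambda>a. q * a + i) ` {..<n div q + 1}" by blast
    qed
    from card_mono[OF _ this] have "card (cluster n ?c i) \<le> n div q + 1"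
      by (simp add: card_image[OF inj])
    ultimately show ?thesis ..
  qed
  have "?c \<in> balanced_partitions n q"
    unfolding balanced_partitions_def
  proof (intro CollectI conjI allI impI)
    show "?c \<in> {..<n} \<rightarrow>\<^sub>E {..<q}" using assms by auto
    fix i j assume "i < q" "j < q"
    with size[of i] size[of j] show "card (cluster n ?c i) \<le> card (cluster n ?c j) + 1"
      by linarith
  qed
  with fin show "set_pmf (random_partition n q) = balanced_partitions n q"
    unfolding random_partition_def by (intro set_pmf_of_set) auto
qed

text \<open>Fubini for finite supports: bounds that hold for every fixed \<open>b\<close> survive
  averaging over \<open>b\<close>. Here \<open>b\<close> will be the partition.\<close>

lemma expectation_pair_pmf_bounds:
  fixes f :: "'a \<times> 'b \<Rightarrow> real"
  assumes "finite (set_pmf A)" "finite (set_pmf B)"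
    and "\<And>b. b \<in> set_pmf B \<Longrightarrow> measure_pmf.expectation A (\<lambda>a. f (a, b)) \<in> {l..u}"
  shows "measure_pmf.expectation (pair_pmf A B) f \<in> {l..u}"
proof -
  have "measure_pmf.expectation (pair_pmf A B) f
      = (\<Sum>z\<in>set_pmf A \<times> set_pmf B. f z * pmf (pair_pmf A B) z)"
    using assms(1,2) by (intro integral_measure_pmf_real) auto
  also have "\<dots> = (\<Sum>b\<in>set_pmf B. \<Sum>a\<in>set_pmf A. f (a, b) * (pmf A a * pmf B b))"
    by (subst sum.swap) (auto simp: sum.cartesian_product pmf_pair intro!: sum.cong)
  also have "\<dots> = (\<Sum>b\<in>set_pmf B. measure_pmf.expectation A (\<lambda>a. f (a, b)) * pmf B b)"
    by (intro sum.cong refl, subst integral_measure_pmf_real[OF assms(1)])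
      (auto simp: sum_distrib_left mult_ac)
  also have "\<dots> = measure_pmf.expectation B (\<lambda>b. measure_pmf.expectation A (\<lambda>a. f (a, b)))"
    using assms(2) by (intro integral_measure_pmf_real[symmetric]) auto
  finally have eq: "measure_pmf.expectation (pair_pmf A B) f
      = measure_pmf.expectation B (\<lambda>b. measure_pmf.expectation A (\<lambda>a. f (a, b)))" .
  have int: "integrable (measure_pmf B) g" for g :: "'b \<Rightarrow> real"
    by (intro integrable_measure_pmf_finite assms(2))
  show ?thesis
    unfolding eq using assms(3)
    by (auto intro!: measure_pmf.integral_ge_const measure_pmf.integral_le_const int
        simp: AE_measure_pmf_iff)
qed

text \<open>By the minimal cluster size, \<open>x\<close> bounds from below the expected number of
  edges between two clusters. The upper bounds count all super-nodes as neighbours, or apply the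
  union bound to each pair.\<close>

lemma expected_coarse_degree_bounds:
  fixes n q :: nat and p r x :: real
  defines "q \<equiv> num_clusters r n"
  assumes p: "0 \<le> p" "p \<le> 1" and q: "1 \<le> q" "q \<le> n"
  defines "x \<equiv> p * (real n)\<^sup>2 / (4 * (real q)\<^sup>2)"
  shows "real n / real q + (real q - 1) * (x / (1 + x)) \<le> expected_coarse_degree n p r"
    and "expected_coarse_degree n p r \<le> real n / real q + real q"
    and "expected_coarse_degree n p r \<le> real n / real q + p * (real n)\<^sup>2 / real q"
proof -
  have x0: "x \<ge> 0" unfolding x_def using p by simp
  have "measure_pmf.expectation (gnp n p) (coarse_average_degree n q c)
      \<in> {real n / real q + (real q - 1) * (x / (1 + x))..
         real n / real q + min (real q) (p * (real n)\<^sup>2 / real q)}"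
    if c: "c \<in> balanced_partitions n q" for c
  proof -
    have c': "c \<in> {..<n} \<rightarrow> {..<q}"
      using c unfolding balanced_partitions_def PiE_def by auto
    define s where "s i = card (cluster n c i)" for i
    define P where "P i j = 1 - (1 - p) ^ (s i * s j)" for i j
    define H where "H = (\<Sum>i<q. \<Sum>j\<in>{..<q} - {i}. P i j)"
    have P0: "P i j \<ge> 0" for i j
      unfolding P_def using p by (simp add: power_le_one)
    have exp: "measure_pmf.expectation (gnp n p) (coarse_average_degree n q c)
        = real n / real q + H / real q"
      unfolding expectation_coarse_average_degree[OF c' p] H_def P_def s_def ..
    \<comment> \<open>Adding the nonnegative diagonal terms lets the union bound factor into
      \<open>p\<close> times the square of the sum of cluster sizes, which is
      \<open>n\<close>.\<close>
    have "H \<le> (\<Sum>i<q. \<Sum>j\<in>{..<q}. P i j)"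
      unfolding H_def using P0 by (intro sum_mono sum_mono2) auto
    moreover have "\<dots> \<le> (\<Sum>i<q. \<Sum>j\<in>{..<q}. 1)"
      unfolding P_def using p by (intro sum_mono) auto
    moreover have "(\<Sum>i<q. \<Sum>j\<in>{..<q}. P i j) \<le> (\<Sum>i<q. \<Sum>j\<in>{..<q}. real (s i) * real (s j) * p)"
      unfolding P_def using hitting_probability_le[OF p] by (intro sum_mono) (metis of_nat_mult)
    moreover have "\<dots> = p * (\<Sum>i<q. real (s i)) * (\<Sum>i<q. real (s i))"
      by (simp add: sum_product sum_distrib_left mult_ac)
    moreover have "(\<Sum>i<q. real (s i)) = real n"
      using sum_card_clusters[OF c'] unfolding s_def by (metis of_nat_sum)
    ultimately have up: "H \<le> real q * real q" "H \<le> p * (real n)\<^sup>2"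
      by (auto simp: power2_eq_square)
    have "x / (1 + x) \<le> P i j" if "i < q" "j < q" for i j
    proof -
      have "real n / (2 * real q) * (real n / (2 * real q)) \<le> real (s i) * real (s j)"
        unfolding s_def using balanced_cluster_ge[OF c q] that by (intro mult_mono) auto
      hence "p * (real n / (2 * real q) * (real n / (2 * real q))) \<le> p * (real (s i) * real (s j))"
        using p by (intro mult_left_mono)
      hence "x \<le> real (s i * s j) * p"
        unfolding x_def by (simp add: power2_eq_square mult_ac)
      thus ?thesis
        unfolding P_def using x0 p by (intro hitting_probability_ge)
    qed
    hence "(\<Sum>i<q. \<Sum>j\<in>{..<q} - {i}. x / (1 + x)) \<le> H"
      unfolding H_def by (intro sum_mono) auto
    hence "real q * ((real q - 1) * (x / (1 + x))) \<le> H"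
      using q by (simp add: of_nat_diff)
    hence "(real q - 1) * (x / (1 + x)) \<le> H / real q"
      using q by (simp add: pos_le_divide_eq mult_ac)
    moreover have "H / real q \<le> real q" "H / real q \<le> p * (real n)\<^sup>2 / real q"
      using up q by (auto simp: pos_divide_le_eq divide_right_mono)
    ultimately show ?thesis unfolding exp by auto
  qed
  hence "expected_coarse_degree n p r \<in> {real n / real q + (real q - 1) * (x / (1 + x))..
         real n / real q + min (real q) (p * (real n)\<^sup>2 / real q)}"
    unfolding expected_coarse_degree_def Let_def q_def[symmetric]
    using set_pmf_random_partition[OF q(1), of n]
    by (intro expectation_pair_pmf_bounds) (auto simp: finite_set_pmf_gnp)
  thus "real n / real q + (real q - 1) * (x / (1 + x)) \<le> expected_coarse_degree n p r"
    and "expected_coarse_degree n p r \<le> real n / real q + real q"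
    and "expected_coarse_degree n p r \<le> real n / real q + p * (real n)\<^sup>2 / real q"
    by auto
qed

subsection \<open>Asymptotics\<close>

lemma real_powr_bigo_iff:
  "(\<lambda>n. real n powr a) \<in> O(\<lambda>n. real n powr b) \<longleftrightarrow> a \<le> b"
  by (rule powr_bigo_iff) (auto simp: filterlim_real_sequentially)

lemma eventually_le_imp_bigo:
  fixes f g :: "'a \<Rightarrow> real"
  assumes "\<forall>\<^sub>F x in F. f x \<le> g x" "\<forall>\<^sub>F x in F. 0 \<le> f x"
  shows "f \<in> O[F](g)"
proof (rule bigoI[of _ 1])
  show "\<forall>\<^sub>F x in F. norm (f x) \<le> 1 * norm (g x)"
    using assms by eventually_elim auto
qed

lemma expected_original_degree_bigtheta:
  assumes "\<And>n. 0 \<le> p n \<and> p n \<le> 1"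
  shows "(\<lambda>n. expected_original_degree n (p n)) \<in> \<Theta>(\<lambda>n. 1 + real n * p n)"
proof (rule bigthetaI'[of "1/4" 1])
  show "\<forall>\<^sub>F n in sequentially.
      1/4 * norm (1 + real n * p n) \<le> norm (expected_original_degree n (p n)) \<and>
      norm (expected_original_degree n (p n)) \<le> 1 * norm (1 + real n * p n)"
    using eventually_ge_at_top[of 2]
  proof eventually_elim
    case (elim n)
    \<comment> \<open>For \<open>n \<ge> 2\<close> the correction \<open>p n / 2\<close> is at most
      a quarter of \<open>real n * p n\<close>; hence the constant \<open>1/4\<close>.\<close>
    have "2 * p n \<le> real n * p n" "0 \<le> p n"
      using assms[of n] elim by (auto intro: mult_right_mono)
    moreover have "expected_original_degree n (p n) = 1 + (real n - 1) * p n / 2"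
      using assms[of n] elim by (intro expected_original_degree_eq) auto
    moreover have "\<dots> = 1 + real n * p n / 2 - p n / 2"
      by (simp add: field_simps)
    ultimately show ?case
      using assms[of n] by auto
  qed
qed auto

text \<open>Rounding down a real that is at least 1 loses at most a factor 2, and
  \<open>n / (m + n)\<close> times \<open>n\<close> is \<open>n\<close> over the original
  degree.\<close>

lemma num_clusters_bigtheta:
  assumes "r \<in> \<Theta>(\<lambda>n. real n / (expected_edges n (p n) + real n))"
    and "\<forall>\<^sub>F n in sequentially. 1 \<le> num_clusters (r n) n"
  shows "(\<lambda>n. real (num_clusters (r n) n)) \<in>
    \<Theta>(\<lambda>n. real n / expected_original_degree n (p n))"
proof -
  have "(\<lambda>n. real (num_clusters (r n) n)) \<in> \<Theta>(\<lambda>n. r n * real n)"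
  proof (rule bigthetaI'[of "1/2" 1])
    show "\<forall>\<^sub>F n in sequentially.
        1/2 * norm (r n * real n) \<le> norm (real (num_clusters (r n) n)) \<and>
        norm (real (num_clusters (r n) n)) \<le> 1 * norm (r n * real n)"
      using assms(2)
    proof eventually_elim
      case (elim n)
      hence floor: "\<lfloor>r n * real n\<rfloor> \<ge> 1"
        "real (num_clusters (r n) n) = of_int \<lfloor>r n * real n\<rfloor>"
        unfolding num_clusters_def by linarith+
      have "r n * real n \<ge> 1" "r n * real n \<le> 2 * of_int \<lfloor>r n * real n\<rfloor>"
        using floor(1) by linarith+
      thus ?case unfolding floor(2) by simp
    qed
  qed auto
  also have "(\<lambda>n. r n * real n) \<in>
      \<Theta>(\<lambda>n. real n / (expected_edges n (p n) + real n) * real n)"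
    by (intro landau_theta.mult assms(1)) auto
  also have "(\<lambda>n. real n / (expected_edges n (p n) + real n) * real n) =
      (\<lambda>n. real n / expected_original_degree n (p n))"
    by (simp add: expected_original_degree_def fun_eq_iff)
  finally show ?thesis .
qed

text \<open>The growth rate of \<open>r\<close> leaves constants open, so it could still yield no
  cluster, or more clusters than nodes; the last assumption excludes this for large
  \<open>n\<close>.\<close>

theorem theorem6:
  fixes p r :: "nat \<Rightarrow> real" and \<beta> :: real
  assumes "\<And>n. 0 \<le> p n \<and> p n \<le> 1"
    and "p \<in> \<Theta>(\<lambda>n. real n powr (- \<beta>))"
    and "r \<in> \<Theta>(\<lambda>n. real n / (expected_edges n (p n) + real n))"
    and "\<forall>\<^sub>F n in sequentially. 1 \<le> num_clusters (r n) n \<and> num_clusters (r n) n \<le> n"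
  shows "preserves_degree p r \<longleftrightarrow> \<beta> \<in> {0..1/2} \<union> {1..}"
proof -
  define q where "q n = num_clusters (r n) n" for n
  define d where "d n = expected_original_degree n (p n)" for n
  define D where "D n = expected_coarse_degree n (p n) (r n)" for n
  define x where "x n = p n * (real n)\<^sup>2 / (4 * (real (q n))\<^sup>2)" for n
  have p: "0 \<le> p n" "p n \<le> 1" for n using assms(1) by auto
  have ev: "\<forall>\<^sub>F n in sequentially. 1 \<le> q n \<and> q n \<le> n \<and> 1 \<le> n"
    using assms(4) unfolding q_def by eventually_elim auto
  have ev_pos: "\<forall>\<^sub>F n in sequentially. 0 < q n \<and> 0 < n \<and> 0 < d n"
    using ev
  proof eventually_elim
    case (elim n)
    thus ?case
      unfolding d_def using p[of n] by (auto simp: expected_original_degree_eq add_pos_nonneg)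
  qed
  have x0: "x n \<ge> 0" for n unfolding x_def using p by simp

  \<comment> \<open>Bounds on the coarse degree for large \<open>n\<close>\<close>
  have lower: "\<forall>\<^sub>F n in sequentially. real n / real (q n) + (real (q n) - 1) * (x n / (1 + x n)) \<le> D n"
    using ev unfolding D_def x_def q_def
    by eventually_elim (rule expected_coarse_degree_bounds(1)[OF p], auto)
  have upper1: "\<forall>\<^sub>F n in sequentially. D n \<le> real n / real (q n) + real (q n)"
    using ev unfolding D_def q_def
    by eventually_elim (rule expected_coarse_degree_bounds(2)[OF p], auto)
  have upper2: "\<forall>\<^sub>F n in sequentially. D n \<le> real n / real (q n) + p n * (real n)\<^sup>2 / real (q n)"
    using ev unfolding D_def q_def
    by eventually_elim (rule expected_coarse_degree_bounds(3)[OF p], auto)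
  have vertical_le: "\<forall>\<^sub>F n in sequentially. real n / real (q n) \<le> D n"
    using lower ev
  proof eventually_elim
    case (elim n)
    have "0 \<le> (real (q n) - 1) * (x n / (1 + x n))"
      using elim x0[of n] by (intro mult_nonneg_nonneg) auto
    with elim show ?case by linarith
  qed
  have D0: "\<forall>\<^sub>F n in sequentially. 0 \<le> D n"
    using vertical_le by eventually_elim (meson divide_nonneg_nonneg of_nat_0_le_iff order_trans)

  \<comment> \<open>Orders of growth of \<open>d\<close> and \<open>q\<close>\<close>
  have p_theta: "p \<in> \<Theta>(\<lambda>n. real n powr (- \<beta>))" by (fact assms(2))
  have np: "(\<lambda>n. real n * p n) \<in> \<Theta>(\<lambda>n. real n powr (1 - \<beta>))"
  proof -
    have "(\<lambda>n. real n * p n) \<in> \<Theta>(\<lambda>n. real n * real n powr (- \<beta>))"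
      by (intro landau_theta.mult p_theta) auto
    also have "(\<lambda>n. real n * real n powr (- \<beta>)) = (\<lambda>n. real n powr (1 - \<beta>))"
      by (auto simp: fun_eq_iff powr_diff powr_minus_divide)
    finally show ?thesis .
  qed
  have d_theta': "d \<in> \<Theta>(\<lambda>n. 1 + real n * p n)"
    unfolding d_def using assms(1) by (rule expected_original_degree_bigtheta)
  have q_theta: "(\<lambda>n. real (q n)) \<in> \<Theta>(\<lambda>n. real n / d n)"
    unfolding q_def d_def using assms(3,4)
    by (intro num_clusters_bigtheta) (auto elim: eventually_mono)
  have vertical_theta: "(\<lambda>n. real n / real (q n)) \<in> \<Theta>(d)"
  proof -
    have "(\<lambda>n. real n / real (q n)) \<in> \<Theta>(\<lambda>n. real n / (real n / d n))"
      using ev_pos by (intro landau_theta.divide) (auto elim: eventually_mono simp: q_theta bigtheta_sym)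
    also have "(\<lambda>n. real n / (real n / d n)) \<in> \<Theta>(d)"
      by (intro bigthetaI_cong eventually_mono[OF ev_pos]) auto
    finally show ?thesis .
  qed
  have preserves_iff: "preserves_degree p r \<longleftrightarrow> D \<in> O(d)"
  proof -
    have "(\<lambda>n. real n / real (q n)) \<in> O(D)"
      using vertical_le by (rule eventually_le_imp_bigo) auto
    hence "d \<in> O(D)"
      using vertical_theta landau_o.big.bigtheta_trans2 bigtheta_sym
      by (meson landau_o.big_trans bigthetaD1)
    thus ?thesis
      unfolding preserves_degree_def D_def[symmetric] d_def[symmetric]
      by (auto simp: bigtheta_def bigomega_iff_bigo)
  qed

  have "\<beta> \<ge> 0"
  proof -
    have "(\<lambda>n. real n powr (- \<beta>)) \<in> O(p)"
      using p_theta by (simp add: bigtheta_sym bigthetaD1)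
    \<comment> \<open>The constant 1 becomes a power so that exponents can be compared. Since
      \<open>0 powr 0 = 0\<close>, this needs \<open>n \<ge> 1\<close>, supplied by
      \<open>ev\<close>.\<close>
    also have "p \<in> O(\<lambda>n. real n powr 0)"
      using p by (intro bigoI[of _ 1] eventually_mono[OF ev]) auto
    finally show ?thesis by (simp add: real_powr_bigo_iff del: powr_zero_eq_one)
  qed
  have d_theta: "d \<in> \<Theta>(\<lambda>n. real n powr (1 - \<beta>))" if "\<beta> \<le> 1"
  proof -
    \<comment> \<open>For \<open>\<beta> \<le> 1\<close> the constant 1 is absorbed by
      \<open>real n * p n\<close>.\<close>
    have "(\<lambda>n. 1 + real n * p n) \<in> \<Theta>(\<lambda>n. real n powr (1 - \<beta>))"
    proof
      have "(\<lambda>n. 1) \<in> O(\<lambda>n. real n powr 0)"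
        by (intro bigoI[of _ 1] eventually_mono[OF ev]) auto
      also have "(\<lambda>n. real n powr 0) \<in> O(\<lambda>n. real n powr (1 - \<beta>))"
        using that by (subst real_powr_bigo_iff) auto
      finally show "(\<lambda>n. 1 + real n * p n) \<in> O(\<lambda>n. real n powr (1 - \<beta>))"
        using np by (intro sum_in_bigo) auto
      have "(\<lambda>n. real n * p n) \<in> O(\<lambda>n. 1 + real n * p n)"
        using p by (intro bigoI[of _ 1] always_eventually) auto
      thus "(\<lambda>n. 1 + real n * p n) \<in> \<Omega>(\<lambda>n. real n powr (1 - \<beta>))"
        using np unfolding bigomega_iff_bigo
        by (meson bigthetaD1 bigtheta_sym landau_o.big_trans)
    qed
    with d_theta' show ?thesis by (rule landau_theta.trans)
  qed
  have q_theta_powr: "(\<lambda>n. real (q n)) \<in> \<Theta>(\<lambda>n. real n powr \<beta>)" if "\<beta> \<le> 1"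
  proof -
    have "(\<lambda>n. real (q n)) \<in> \<Theta>(\<lambda>n. real n / d n)" by (fact q_theta)
    also have "(\<lambda>n. real n / d n) \<in> \<Theta>(\<lambda>n. real n / real n powr (1 - \<beta>))"
      using ev_pos d_theta[OF that] by (intro landau_theta.divide)
        (auto elim: eventually_mono simp: bigtheta_sym)
    also have "(\<lambda>n. real n / real n powr (1 - \<beta>)) = (\<lambda>n. real n powr \<beta>)"
      by (auto simp: fun_eq_iff powr_diff)
    finally show ?thesis .
  qed

  \<comment> \<open>The three ranges of the exponent\<close>
  consider "\<beta> \<le> 1/2" | "1 \<le> \<beta>" | "1/2 < \<beta>" "\<beta> < 1" by linarith
  thus ?thesis
  proof cases
    case 1
    have "(\<lambda>n. real (q n)) \<in> \<Theta>(\<lambda>n. real n powr \<beta>)"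
      using 1 by (intro q_theta_powr) auto
    also have "(\<lambda>n. real n powr \<beta>) \<in> O(\<lambda>n. real n powr (1 - \<beta>))"
      using 1 by (subst real_powr_bigo_iff) auto
    also have "(\<lambda>n. real n powr (1 - \<beta>)) \<in> \<Theta>(d)"
      using d_theta 1 by (simp add: bigtheta_sym)
    finally have "(\<lambda>n. real n / real (q n) + real (q n)) \<in> O(d)"
      using vertical_theta by (intro sum_in_bigo) auto
    moreover have "D \<in> O(\<lambda>n. real n / real (q n) + real (q n))"
      using upper1 D0 by (rule eventually_le_imp_bigo)
    ultimately have "D \<in> O(d)" by (metis landau_o.big_trans)
    thus ?thesis using preserves_iff 1 \<open>\<beta> \<ge> 0\<close> by auto
  next
    case 2
    have "(\<lambda>n. real n * p n) \<in> O(\<lambda>n. real n powr (1 - \<beta>))" using np by auto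
    also have "(\<lambda>n. real n powr (1 - \<beta>)) \<in> O(\<lambda>n. real n powr 0)"
      using 2 by (subst real_powr_bigo_iff) auto
    also have "(\<lambda>n. real n powr 0) \<in> O(\<lambda>n. 1)"
      by (intro bigoI[of _ 1] eventually_mono[OF ev]) auto
    finally have np1: "(\<lambda>n. real n * p n) \<in> O(\<lambda>n. 1)" .
    \<comment> \<open>The surviving-edge bound splits into \<open>real n * p n\<close>, which is
      bounded here, and the vertical degree, which is of order \<open>d\<close>.\<close>
    have "(\<lambda>n. p n * (real n)\<^sup>2 / real (q n)) = (\<lambda>n. (real n * p n) * (real n / real (q n)))"
      by (simp add: fun_eq_iff power2_eq_square)
    also have "\<dots> \<in> O(\<lambda>n. 1 * d n)"
      using vertical_theta by (intro landau_o.big.mult np1) auto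
    finally have "(\<lambda>n. real n / real (q n) + p n * (real n)\<^sup>2 / real (q n)) \<in> O(d)"
      using vertical_theta by (intro sum_in_bigo) auto
    moreover have "D \<in> O(\<lambda>n. real n / real (q n) + p n * (real n)\<^sup>2 / real (q n))"
      using upper2 D0 by (rule eventually_le_imp_bigo)
    ultimately have "D \<in> O(d)" by (metis landau_o.big_trans)
    thus ?thesis using preserves_iff 2 by auto
  next
    case 3
    have "D \<notin> O(d)"
    proof
      assume "D \<in> O(d)"
      hence D_bigo: "D \<in> O(\<lambda>n. real n powr (1 - \<beta>))"
        using d_theta 3 by (meson bigthetaD1 landau_o.big_trans less_imp_le)
      have q_th: "(\<lambda>n. real (q n)) \<in> \<Theta>(\<lambda>n. real n powr \<beta>)"
        using 3 by (intro q_theta_powr) auto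
      have x_theta: "x \<in> \<Theta>(\<lambda>n. real n powr (2 - 3 * \<beta>))"
      proof -
        have "x \<in> \<Theta>(\<lambda>n. p n * (real n)\<^sup>2 / (real (q n))\<^sup>2)"
          unfolding x_def by (rule bigthetaI'[of "1/4" 1]) (auto intro!: always_eventually simp: divide_simps)
        also have "(\<lambda>n. p n * (real n)\<^sup>2 / (real (q n))\<^sup>2) \<in>
            \<Theta>(\<lambda>n. real n powr (- \<beta>) * (real n)\<^sup>2 / (real n powr \<beta>)\<^sup>2)"
          using ev_pos q_th p_theta unfolding power2_eq_square
          by (intro landau_theta.mult landau_theta.divide)
            (auto elim: eventually_mono simp: bigtheta_sym)
        also have "(\<lambda>n. real n powr (- \<beta>) * (real n)\<^sup>2 / (real n powr \<beta>)\<^sup>2) \<in>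
            \<Theta>(\<lambda>n. real n powr (2 - 3 * \<beta>))"
        proof (intro bigthetaI_cong eventually_mono[OF ev])
          fix n assume "1 \<le> q n \<and> q n \<le> n \<and> 1 \<le> n"
          hence "(real n)\<^sup>2 = real n powr 2" by simp
          moreover have "(real n powr \<beta>)\<^sup>2 = real n powr (2 * \<beta>)"
            by (simp add: power2_eq_square flip: powr_add)
          ultimately show "real n powr (- \<beta>) * (real n)\<^sup>2 / (real n powr \<beta>)\<^sup>2 =
              real n powr (2 - 3 * \<beta>)"
            by (simp only: flip: powr_add powr_diff) simp
        qed
        finally show ?thesis .
      qed
      \<comment> \<open>As \<open>\<beta> > 0\<close>, \<open>q\<close> tends to infinity, so
        eventually \<open>q \<ge> 2\<close> and \<open>q \<le> 2 * (q - 1)\<close>.\<close>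
      have "(\<lambda>n. real n powr \<beta>) \<in> O(\<lambda>n. real (q n) - 1)"
      proof -
        have "(\<lambda>n. 1) \<in> o(\<lambda>n. real n powr \<beta>)"
          using 3 by real_asymp
        also have "(\<lambda>n. real n powr \<beta>) \<in> \<Theta>(\<lambda>n. real (q n))"
          using q_th by (simp add: bigtheta_sym)
        finally have "\<forall>\<^sub>F n in sequentially. norm (1 :: real) \<le> 1/2 * norm (real (q n))"
          by (rule landau_o.smallD) auto
        hence "(\<lambda>n. real (q n)) \<in> O(\<lambda>n. real (q n) - 1)"
          by (intro bigoI[of _ 2]) (auto elim!: eventually_mono)
        moreover have "(\<lambda>n. real n powr \<beta>) \<in> O(\<lambda>n. real (q n))"
          using q_th by (simp add: bigtheta_sym bigthetaD1)
        ultimately show ?thesis by (metis landau_o.big_trans)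
      qed
      hence "(\<lambda>n. real n powr \<beta> * real n powr (2 - 3 * \<beta>)) \<in> O(\<lambda>n. (real (q n) - 1) * x n)"
        using x_theta by (intro landau_o.big.mult) (auto simp: bigtheta_sym bigthetaD1)
      \<comment> \<open>The exponent \<open>2 - 3 * \<beta>\<close> of \<open>x\<close> changes sign
        at \<open>\<beta> = 2/3\<close>. Multiplying by \<open>1 + x\<close> treats growing and
        vanishing \<open>x\<close> together.\<close>
      also have "(\<lambda>n. (real (q n) - 1) * x n) \<in> O(\<lambda>n. D n * (1 + x n))"
      proof (rule bigoI[of _ 1])
        show "\<forall>\<^sub>F n in sequentially. norm ((real (q n) - 1) * x n) \<le> 1 * norm (D n * (1 + x n))"
          using lower ev D0
        proof eventually_elim
          case (elim n)
          have "(real (q n) - 1) * (x n / (1 + x n)) \<le> D n"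
            using elim by (smt (verit) divide_nonneg_nonneg of_nat_0_le_iff)
          hence "(real (q n) - 1) * x n \<le> D n * (1 + x n)"
            using x0[of n] by (simp add: pos_divide_le_eq)
          thus ?case using elim x0[of n] by (simp add: abs_mult)
        qed
      qed
      also have "(\<lambda>n. D n * (1 + x n)) \<in>
          O(\<lambda>n. real n powr (1 - \<beta>) * (1 + real n powr (2 - 3 * \<beta>)))"
      proof (intro landau_o.big.mult D_bigo)
        obtain C where "C > 0" "\<forall>\<^sub>F n in sequentially. norm (x n) \<le> C * norm (real n powr (2 - 3 * \<beta>))"
          using bigthetaD1[OF x_theta] landau_o.bigE by blast
        thus "(\<lambda>n. 1 + x n) \<in> O(\<lambda>n. 1 + real n powr (2 - 3 * \<beta>))"
          using x0 by (intro bigoI[of _ "max 1 C"])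
            (auto elim!: eventually_mono simp: abs_of_nonneg algebra_simps intro!: add_mono
              order_trans[OF _ mult_right_mono[of C "max 1 C"]])
      qed
      also have "(\<lambda>n. real n powr (1 - \<beta>) * (1 + real n powr (2 - 3 * \<beta>))) \<in>
          O(\<lambda>n. real n powr max (1 - \<beta>) (3 - 4 * \<beta>))"
      proof -
        have "(\<lambda>n. real n powr (1 - \<beta>) + real n powr (3 - 4 * \<beta>)) \<in>
            O(\<lambda>n. real n powr max (1 - \<beta>) (3 - 4 * \<beta>))"
          by (intro sum_in_bigo) (subst real_powr_bigo_iff, simp)+
        thus ?thesis by (simp add: distrib_left flip: powr_add)
      qed
      \<comment> \<open>The first alternative of the maximum would force
        \<open>\<beta> \<ge> 1\<close>, the second \<open>\<beta> \<le> 1/2\<close>.\<close>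
      finally have "2 - 2 * \<beta> \<le> max (1 - \<beta>) (3 - 4 * \<beta>)"
        by (simp add: real_powr_bigo_iff flip: powr_add)
      with 3 show False by (simp add: max_def split: if_splits)
    qed
    thus ?thesis using preserves_iff 3 by auto
  qed
qed

end
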